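(* Let $(u',\alpha')$, with $u':S\to\mathbb{R}$ and $\alpha'\in[0,1]$, be a solution of the inf-sup equation $$u'(s)=\inf_{p_s\in\mathcal{P}_s}\sup_{\phi\in Q}\sum_{a\in A}\sum_{s'\in S}\phi(a)p_s(s'|a)\big[r(s,a)-\alpha'+u'(s')\big]\qquad\forall s\in S.$$ Either of the following conditions is sufficient for $(u',\alpha')$ to also solve the robust Bellman equation $$u'(s)=\sup_{\phi\in Q}\inf_{p_s\in\mathcal{P}_s}\sum_{a\in A}\sum_{s'\in S}\phi(a)p_s(s'|a)\big[r(s,a)-\alpha'+u'(s')\big]\qquad\forall s\in S:$$ (1) $Q$ and each $\mathcal{P}_s$, $s\in S$, are convex, and either $Q$ is compact or all $\mathcal{P}_s$, $s\in S$, are compact. (2) $\{\delta_a:a\in A\}\subseteq Q$, and for every $s\in S$ the ambiguity set factorizes as $\mathcal{P}_s=\prod_{a\in A}\mathcal{P}_{s,a}$ for some sets $\mathcal{P}_{s,a}\subseteq\mathrm{Prob}(S)$ (SA-rectangularity).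
   Context: $S$ (states) and $A$ (actions) are finite nonempty sets; $\mathrm{Prob}(E)$ is the set of probability distributions on a finite set $E$; $\delta_a\in\mathrm{Prob}(A)$ is the Dirac measure at $a$; $r:S\times A\to[0,1]$ is a reward function. $Q\subseteq\mathrm{Prob}(A)$ is nonempty, and for each $s\in S$, $\mathcal{P}_s$ is a nonempty set of maps $p_s:A\to\mathrm{Prob}(S)$, written $p_s(s'|a)$. Compactness and convexity are as subsets of $\mathbb{R}^{|A|}$ and $\mathbb{R}^{|A|\times|S|}$. In (2), $\mathcal{P}_s=\prod_{a}\mathcal{P}_{s,a}$ means $p_s\in\mathcal{P}_s$ iff $p_s(\cdot|a)\in\mathcal{P}_{s,a}$ for every $a\in A$. *)

theory Defs
  imports "HOL-Analysis.Analysis"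
begin

text \<open>
  The finite nonempty sets of states and actions are types \<open>'s\<close>, \<open>'a\<close> of class
  \<open>finite\<close>. Distributions are vectors and kernels are matrices \<open>p\<close> with rows
  \<open>p $ a = p(.|a)\<close>, so that \<open>convex\<close> and \<open>compact\<close> are the Euclidean notions.
\<close>

definition Prob :: "(real ^ 'e::finite) set" where
  "Prob = {x. (\<forall>i. 0 \<le> x $ i) \<and> (\<Sum>i\<in>UNIV. x $ i) = 1}"

definition dirac :: "'e \<Rightarrow> real ^ 'e::finite" where
  "dirac i = axis i 1"

definition kernels :: "(real ^ 's::finite ^ 'a::finite) set" where
  "kernels = {p. \<forall>a. p $ a \<in> Prob}"

definition bellman_payoff ::
  "('s::finite \<Rightarrow> 'a::finite \<Rightarrow> real) \<Rightarrow> ('s \<Rightarrow> real) \<Rightarrow> real \<Rightarrow> 's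
    \<Rightarrow> real ^ 'a \<Rightarrow> real ^ 's ^ 'a \<Rightarrow> real" where
  "bellman_payoff r u \<alpha> s \<phi> p =
    (\<Sum>a\<in>UNIV. \<Sum>s'\<in>UNIV. \<phi> $ a * p $ a $ s' * (r s a - \<alpha> + u s'))"

text \<open>
  For \<open>Q \<subseteq> Prob\<close> and \<open>P s \<subseteq> kernels\<close>, both nonempty, the payoff is bounded on
  \<open>Q \<times> P s\<close>, so all the infima and suprema below are taken over nonempty bounded sets
  of reals and have their usual meaning.
\<close>

definition solves_inf_sup ::
  "('s::finite \<Rightarrow> 'a::finite \<Rightarrow> real) \<Rightarrow> (real ^ 'a) set \<Rightarrow> ('s \<Rightarrow> (real ^ 's ^ 'a) set)
    \<Rightarrow> ('s \<Rightarrow> real) \<Rightarrow> real \<Rightarrow> bool" where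
  "solves_inf_sup r Q P u \<alpha> \<longleftrightarrow>
    (\<forall>s. u s = (INF p\<in>P s. SUP \<phi>\<in>Q. bellman_payoff r u \<alpha> s \<phi> p))"

definition solves_robust_bellman ::
  "('s::finite \<Rightarrow> 'a::finite \<Rightarrow> real) \<Rightarrow> (real ^ 'a) set \<Rightarrow> ('s \<Rightarrow> (real ^ 's ^ 'a) set)
    \<Rightarrow> ('s \<Rightarrow> real) \<Rightarrow> real \<Rightarrow> bool" where
  "solves_robust_bellman r Q P u \<alpha> \<longleftrightarrow>
    (\<forall>s. u s = (SUP \<phi>\<in>Q. INF p\<in>P s. bellman_payoff r u \<alpha> s \<phi> p))"

definition sa_rectangular :: "('s::finite \<Rightarrow> (real ^ 's ^ 'a::finite) set) \<Rightarrow> bool" where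
  "sa_rectangular P \<longleftrightarrow>
    (\<forall>s. \<exists>Psa :: 'a \<Rightarrow> (real ^ 's) set.
      (\<forall>a. Psa a \<subseteq> Prob) \<and> P s = {p. \<forall>a. p $ a \<in> Psa a})"

end

theory Submission
  imports Defs
begin

text \<open>
  For a fixed state the payoff is the inner product of the policy \<open>\<phi>\<close> with the vector of
  expected gains of the single actions under \<open>p\<close>, and that vector is linear in \<open>p\<close>. The theorem
  therefore says that a bilinear game has a value.

  Equality of the two values follows once, for every level \<open>c\<close>, the following holds: if each
  kernel can be answered by a policy with payoff above \<open>c\<close>, then one policy secures \<open>c\<close> against
  all kernels (\<open>inf_sup_eq_sup_inf_if_levels_secured\<close>). Policies and kernel rows have total mass
  one, so increasing the gain \<open>\<alpha>\<close> by \<open>c\<close> lowers every payoff by exactly \<open>c\<close>, and only the level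
  zero has to be treated.

  In the convex case the level zero statement is a theorem of the alternative for the inner
  product (\<open>uniform_nonneg_point\<close>), which comes from separating the compact set from the dual
  cone of the other set. When the kernels rather than the policies are compact, the same theorem
  with exchanged roles yields one kernel that holds all policies down to zero.

  Under rectangularity, if no Dirac policy secures zero, then each action has an admissible row
  with negative gain. These rows form one admissible kernel, against which every policy, being an
  average of actions, has negative payoff.
\<close>

section \<open>Equality of values from secured levels\<close>

text \<open>
  The premise asks for a single \<open>x\<close> only with the weak inequality at \<open>c\<close>, given strict answers:
  every \<open>c\<close> below the inf-sup value has strict answers, and such \<open>c\<close> are dense below it.
\<close>

lemma inf_sup_eq_sup_inf_if_levels_secured:
  fixes f :: "'x \<Rightarrow> 'y \<Rightarrow> real"
  assumes ne: "X \<noteq> {}" "Y \<noteq> {}"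
    and bnd: "\<And>x y. x \<in> X \<Longrightarrow> y \<in> Y \<Longrightarrow> \<bar>f x y\<bar> \<le> B"
    and secured: "\<And>c. (\<And>y. y \<in> Y \<Longrightarrow> \<exists>x\<in>X. c < f x y) \<Longrightarrow> \<exists>x\<in>X. \<forall>y\<in>Y. c \<le> f x y"
  shows "(INF y\<in>Y. SUP x\<in>X. f x y) = (SUP x\<in>X. INF y\<in>Y. f x y)"
proof (rule antisym)
  have above: "bdd_above ((\<lambda>x. f x y) ` X)" if "y \<in> Y" for y
    using bnd[OF _ that] by (intro bdd_aboveI2[where M = B]) (simp add: abs_le_iff)
  have below: "bdd_below (f x ` Y)" if "x \<in> X" for x
  proof (rule bdd_belowI2)
    show "- B \<le> f x y" if "y \<in> Y" for y
      using bnd[OF \<open>x \<in> X\<close> that] by linarith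
  qed
  obtain x0 y0 where x0: "x0 \<in> X" and y0: "y0 \<in> Y" using ne by blast
  have inf_le: "(INF y\<in>Y. f x y) \<le> f x y" if "x \<in> X" "y \<in> Y" for x y
    using below that by (intro cINF_lower) auto
  have le_sup: "f x y \<le> (SUP x\<in>X. f x y)" if "x \<in> X" "y \<in> Y" for x y
    using above that by (intro cSUP_upper) auto
  show "(SUP x\<in>X. INF y\<in>Y. f x y) \<le> (INF y\<in>Y. SUP x\<in>X. f x y)"
    by (intro cSUP_least cINF_greatest ne) (rule order_trans[OF inf_le le_sup])
  have sup_bdd: "bdd_below ((\<lambda>y. SUP x\<in>X. f x y) ` Y)"
  proof (rule bdd_belowI2)
    show "- B \<le> (SUP x\<in>X. f x y)" if "y \<in> Y" for y
      using bnd[OF x0 that] le_sup[OF x0 that] by linarith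
  qed
  have inf_bdd: "bdd_above ((\<lambda>x. INF y\<in>Y. f x y) ` X)"
  proof (rule bdd_aboveI2)
    show "(INF y\<in>Y. f x y) \<le> B" if "x \<in> X" for x
      using bnd[OF that y0] inf_le[OF that y0] by linarith
  qed
  show "(INF y\<in>Y. SUP x\<in>X. f x y) \<le> (SUP x\<in>X. INF y\<in>Y. f x y)"
  proof (rule dense_le)
    fix c assume c: "c < (INF y\<in>Y. SUP x\<in>X. f x y)"
    have "\<exists>x\<in>X. c < f x y" if y: "y \<in> Y" for y
    proof -
      have "c < (SUP x\<in>X. f x y)"
        using c cINF_lower[OF sup_bdd y] by linarith
      then show ?thesis
        using less_cSUP_iff[OF ne(1) above[OF y]] by blast
    qed
    then obtain x where x: "x \<in> X" "\<forall>y\<in>Y. c \<le> f x y"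
      using secured by blast
    then have "c \<le> (INF y\<in>Y. f x y)"
      by (intro cINF_greatest ne) auto
    also have "\<dots> \<le> (SUP x\<in>X. INF y\<in>Y. f x y)"
      by (rule cSUP_upper[OF x(1) inf_bdd])
    finally show "c \<le> (SUP x\<in>X. INF y\<in>Y. f x y)" .
  qed
qed

section \<open>A theorem of the alternative for the inner product\<close>

lemma nonneg_if_multiples_bounded_below:
  fixes m b :: real
  assumes "\<And>t. 0 \<le> t \<Longrightarrow> b < t * m"
  shows "0 \<le> m"
proof (rule ccontr)
  assume "\<not> 0 \<le> m"
  then have "b < (\<bar>b\<bar> / -m) * m"
    by (intro assms divide_nonneg_nonneg) auto
  with \<open>\<not> 0 \<le> m\<close> show False by simp
qed

text \<open>
  This is the half of the bipolar theorem in which separation is used: a point outside the closed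
  cone would be cut off by a functional from the dual cone.
\<close>

lemma in_closure_cone_hull_if_nonneg_on_dual:
  fixes Y :: "'a::euclidean_space set"
  assumes "convex Y" "Y \<noteq> {}"
    and dual: "\<And>z. (\<And>y. y \<in> Y \<Longrightarrow> 0 \<le> z \<bullet> y) \<Longrightarrow> 0 \<le> a \<bullet> z"
  shows "a \<in> closure (cone hull Y)"
proof (rule ccontr)
  assume "a \<notin> closure (cone hull Y)"
  then obtain d b where da: "d \<bullet> a < b" and db: "\<And>x. x \<in> closure (cone hull Y) \<Longrightarrow> b < d \<bullet> x"
    using separating_hyperplane_closed_point[of "closure (cone hull Y)" a]
      convex_cone_hull[OF \<open>convex Y\<close>] convex_closure closed_closure by blast
  have ray: "b < t * (d \<bullet> y)" if "0 \<le> t" "y \<in> Y" for t y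
  proof -
    have "t *\<^sub>R y \<in> closure (cone hull Y)"
      using that closure_subset by (force simp: cone_hull_expl)
    from db[OF this] show ?thesis by simp
  qed
  have "0 \<le> d \<bullet> y" if "y \<in> Y" for y
    using nonneg_if_multiples_bounded_below ray that by blast
  then have "0 \<le> a \<bullet> d" by (rule dual)
  moreover have "b < 0" using ray[of 0] \<open>Y \<noteq> {}\<close> by auto
  ultimately show False using da by (simp add: inner_commute)
qed

text \<open>
  If \<open>X\<close> missed the dual cone of \<open>Y\<close>, a functional \<open>a\<close> would separate them with a negative bound
  on \<open>X\<close> and nonnegative values on the dual cone. Such an \<open>a\<close> is a limit of multiples of points
  of \<open>Y\<close>; as \<open>X\<close> is bounded, a close enough multiple is still negative on all of \<open>X\<close>, and so is
  the point of \<open>Y\<close> itself, which then has no partner in \<open>X\<close>.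
\<close>

lemma uniform_nonneg_point:
  fixes X Y :: "'a::euclidean_space set"
  assumes X: "convex X" "compact X" "X \<noteq> {}"
    and Y: "convex Y" "Y \<noteq> {}"
    and pointwise: "\<And>y. y \<in> Y \<Longrightarrow> \<exists>x\<in>X. 0 \<le> x \<bullet> y"
  shows "\<exists>x\<in>X. \<forall>y\<in>Y. 0 \<le> x \<bullet> y"
proof (rule ccontr)
  assume none: "\<not> (\<exists>x\<in>X. \<forall>y\<in>Y. 0 \<le> x \<bullet> y)"
  define C where "C = (\<Inter>y\<in>Y. {x. 0 \<le> y \<bullet> x})"
  have "closed {x. 0 \<le> y \<bullet> x}" "convex {x. 0 \<le> y \<bullet> x}" for y :: 'a
    using closed_halfspace_ge[of 0 y] convex_halfspace_ge[of 0 y] by simp_all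
  then have C: "convex C" "closed C"
    unfolding C_def by (auto intro: convex_INT)
  have "X \<inter> C = {}" using none by (auto simp: C_def inner_commute)
  then obtain a b where aX: "\<And>x. x \<in> X \<Longrightarrow> a \<bullet> x < b" and aC: "\<And>z. z \<in> C \<Longrightarrow> b < a \<bullet> z"
    using separating_hyperplane_compact_closed[OF X C] by blast
  have "b < 0" using aC[of 0] by (simp add: C_def)
  have "0 \<le> a \<bullet> z" if z: "\<And>y. y \<in> Y \<Longrightarrow> 0 \<le> z \<bullet> y" for z
  proof (rule nonneg_if_multiples_bounded_below)
    fix t :: real assume "0 \<le> t"
    then have "t *\<^sub>R z \<in> C" using z by (auto simp: C_def inner_commute)
    from aC[OF this] show "b < t * (a \<bullet> z)" by simp
  qed
  then have "a \<in> closure (cone hull Y)"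
    using in_closure_cone_hull_if_nonneg_on_dual[OF Y] by blast
  moreover obtain R where R: "R > 0" "\<And>x. x \<in> X \<Longrightarrow> norm x \<le> R"
    using compact_imp_bounded[OF X(2)] bounded_pos by blast
  ultimately obtain v where v: "v \<in> cone hull Y" "dist v a < - b / R"
    using \<open>b < 0\<close> unfolding closure_approachable by (meson divide_pos_pos neg_0_less_iff_less)
  then obtain t y where ty: "v = t *\<^sub>R y" "0 \<le> t" "y \<in> Y"
    by (auto simp: cone_hull_expl)
  obtain x where x: "x \<in> X" "0 \<le> x \<bullet> y" using pointwise ty by blast
  have "(v - a) \<bullet> x \<le> norm (v - a) * norm x" by (rule norm_cauchy_schwarz)
  also have "\<dots> \<le> norm (v - a) * R" using R x by (intro mult_left_mono) auto
  also have "\<dots> \<le> (- b / R) * R"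
    using v(2) R(1) by (intro mult_right_mono) (auto simp: dist_norm)
  also have "\<dots> = - b" using R(1) by simp
  finally have "v \<bullet> x \<le> - b + a \<bullet> x" by (simp add: inner_diff_left)
  then have "v \<bullet> x < 0" using aX[OF x(1)] by simp
  moreover have "0 \<le> v \<bullet> x" using ty x by (simp add: inner_commute)
  ultimately show False by simp
qed

section \<open>The one-state game\<close>

definition action_gain ::
  "('s::finite \<Rightarrow> 'a::finite \<Rightarrow> real) \<Rightarrow> ('s \<Rightarrow> real) \<Rightarrow> real \<Rightarrow> 's
    \<Rightarrow> real ^ 's ^ 'a \<Rightarrow> real ^ 'a" where
  "action_gain r u \<alpha> s p = (\<chi> a. \<Sum>s'\<in>UNIV. p $ a $ s' * (r s a - \<alpha> + u s'))"

lemma bellman_payoff_eq_inner: "bellman_payoff r u \<alpha> s \<phi> p = \<phi> \<bullet> action_gain r u \<alpha> s p"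
  by (simp add: bellman_payoff_def action_gain_def inner_vec_def sum_distrib_left mult.assoc)

lemma linear_action_gain: "linear (action_gain r u \<alpha> s)"
  by (rule linearI)
    (simp_all add: action_gain_def vec_eq_iff distrib_right sum.distrib sum_distrib_left mult.assoc)

lemma bellman_payoff_shift:
  assumes "\<phi> \<in> Prob" "p \<in> kernels"
  shows "bellman_payoff r u (\<alpha> + c) s \<phi> p = bellman_payoff r u \<alpha> s \<phi> p - c"
proof -
  have p1: "(\<Sum>s'\<in>UNIV. p $ a $ s') = 1" for a
    using assms(2) by (simp add: kernels_def Prob_def)
  have "bellman_payoff r u (\<alpha> + c) s \<phi> p
      = (\<Sum>a\<in>UNIV. \<Sum>s'\<in>UNIV. \<phi> $ a * p $ a $ s' * (r s a - \<alpha> + u s') - \<phi> $ a * p $ a $ s' * c)"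
    unfolding bellman_payoff_def by (intro sum.cong refl) (simp add: algebra_simps)
  also have "\<dots> = bellman_payoff r u \<alpha> s \<phi> p - (\<Sum>a\<in>UNIV. \<phi> $ a * (\<Sum>s'\<in>UNIV. p $ a $ s')) * c"
    by (simp add: bellman_payoff_def sum_subtractf sum_distrib_left sum_distrib_right)
  also have "\<dots> = bellman_payoff r u \<alpha> s \<phi> p - c"
    using assms(1) by (simp add: p1 Prob_def)
  finally show ?thesis .
qed

lemma Prob_abs_le_one:
  assumes "x \<in> Prob"
  shows "\<bar>x $ i\<bar> \<le> 1"
proof -
  have "x $ i \<le> (\<Sum>j\<in>UNIV. x $ j)"
    using assms by (intro member_le_sum) (auto simp: Prob_def)
  with assms show ?thesis by (simp add: Prob_def)
qed

lemma bellman_payoff_bounded: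
  assumes "\<phi> \<in> Prob" "p \<in> kernels"
  shows "\<bar>bellman_payoff r u \<alpha> s \<phi> p\<bar> \<le> (\<Sum>a\<in>UNIV. \<Sum>s'\<in>UNIV. \<bar>r s a - \<alpha> + u s'\<bar>)"
  unfolding bellman_payoff_def
proof (intro order_trans[OF sum_abs] sum_mono)
  fix a s'
  have "\<bar>\<phi> $ a\<bar> * \<bar>p $ a $ s'\<bar> \<le> 1 * 1"
    using assms by (intro mult_mono Prob_abs_le_one) (auto simp: kernels_def)
  then show "\<bar>\<phi> $ a * p $ a $ s' * (r s a - \<alpha> + u s')\<bar> \<le> \<bar>r s a - \<alpha> + u s'\<bar>"
    by (simp add: abs_mult mult_left_le_one_le)
qed

lemma policy_secures_zero_compact_policies:
  assumes Q: "convex Q" "compact Q" "Q \<noteq> {}" and P: "convex P" "P \<noteq> {}"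
    and answer: "\<And>p. p \<in> P \<Longrightarrow> \<exists>\<phi>\<in>Q. 0 < bellman_payoff r u \<alpha> s \<phi> p"
  shows "\<exists>\<phi>\<in>Q. \<forall>p\<in>P. 0 \<le> bellman_payoff r u \<alpha> s \<phi> p"
proof -
  have "\<exists>\<phi>\<in>Q. \<forall>y\<in>action_gain r u \<alpha> s ` P. 0 \<le> \<phi> \<bullet> y"
  proof (rule uniform_nonneg_point[OF Q convex_linear_image[OF linear_action_gain P(1)]])
    show "\<exists>\<phi>\<in>Q. 0 \<le> \<phi> \<bullet> y" if "y \<in> action_gain r u \<alpha> s ` P" for y
      using that answer by (force simp: bellman_payoff_eq_inner intro: less_imp_le)
  qed (use P(2) in simp)
  then show ?thesis by (simp add: bellman_payoff_eq_inner)
qed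

text \<open>
  The alternative now picks a kernel: were every policy beaten by some kernel, one kernel would
  push all policies to nonpositive payoff and so have no answer. It yields only a weak bound,
  hence the strict inequality in the answers.
\<close>

lemma policy_secures_zero_compact_kernels:
  assumes Q: "convex Q" "Q \<noteq> {}" and P: "convex P" "compact P" "P \<noteq> {}"
    and answer: "\<And>p. p \<in> P \<Longrightarrow> \<exists>\<phi>\<in>Q. 0 < bellman_payoff r u \<alpha> s \<phi> p"
  shows "\<exists>\<phi>\<in>Q. \<forall>p\<in>P. 0 \<le> bellman_payoff r u \<alpha> s \<phi> p"
proof (rule ccontr)
  assume none: "\<not> ?thesis"
  let ?G = "action_gain r u \<alpha> s ` P"
  have G: "convex ?G" "compact ?G" "?G \<noteq> {}"
    using convex_linear_image[OF linear_action_gain P(1)]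
      compact_continuous_image[OF linear_continuous_on[OF
        linear_action_gain[unfolded linear_conv_bounded_linear]] P(2)] P(3)
    by simp_all
  have "\<exists>g\<in>?G. \<forall>y\<in>uminus ` Q. 0 \<le> g \<bullet> y"
  proof (rule uniform_nonneg_point[OF G])
    show "convex (uminus ` Q)" "uminus ` Q \<noteq> {}"
      using Q by (auto intro: convex_negations)
    show "\<exists>g\<in>?G. 0 \<le> g \<bullet> y" if "y \<in> uminus ` Q" for y
    proof -
      obtain \<phi> where \<phi>: "\<phi> \<in> Q" "y = - \<phi>" using \<open>y \<in> uminus ` Q\<close> by blast
      with none obtain p where "p \<in> P" "bellman_payoff r u \<alpha> s \<phi> p < 0"
        by (meson not_le)
      with \<phi>(2) show ?thesis
        by (intro bexI[of _ "action_gain r u \<alpha> s p"])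
           (auto simp: bellman_payoff_eq_inner inner_commute)
    qed
  qed
  then obtain p where p: "p \<in> P" "\<And>\<phi>. \<phi> \<in> Q \<Longrightarrow> bellman_payoff r u \<alpha> s \<phi> p \<le> 0"
    by (auto simp: bellman_payoff_eq_inner inner_commute)
  then show False
    using answer[OF p(1)] by (meson not_le)
qed

text \<open>
  Convexity is replaced by the freedom to choose the rows of a kernel independently: the rows
  that beat the Dirac policies, each taken from its own kernel, combine into one kernel that
  beats every mixture of them.
\<close>

lemma policy_secures_zero_rectangular:
  assumes Q: "range dirac \<subseteq> Q" "Q \<subseteq> Prob"
    and P: "P = {p. \<forall>a. p $ a \<in> Psa a}"
    and answer: "\<And>p. p \<in> P \<Longrightarrow> \<exists>\<phi>\<in>Q. 0 < bellman_payoff r u \<alpha> s \<phi> p"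
  shows "\<exists>\<phi>\<in>Q. \<forall>p\<in>P. 0 \<le> bellman_payoff r u \<alpha> s \<phi> p"
proof (rule ccontr)
  assume none: "\<not> ?thesis"
  have "\<exists>p\<in>P. action_gain r u \<alpha> s p $ a < 0" for a
  proof -
    have "dirac a \<in> Q" using Q by blast
    with none obtain p where "p \<in> P" "bellman_payoff r u \<alpha> s (dirac a) p < 0"
      by (meson not_le)
    then show ?thesis
      by (auto simp: bellman_payoff_eq_inner dirac_def inner_axis')
  qed
  then obtain k where k: "\<And>a. k a \<in> P" "\<And>a. action_gain r u \<alpha> s (k a) $ a < 0"
    by metis
  define p where "p = (\<chi> a. k a $ a)"
  have "p \<in> P" using k(1) by (simp add: P p_def)
  then obtain \<phi> where \<phi>: "\<phi> \<in> Q" "0 < bellman_payoff r u \<alpha> s \<phi> p"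
    using answer by blast
  have "action_gain r u \<alpha> s p $ a < 0" for a
    using k(2)[of a] by (simp add: action_gain_def p_def)
  moreover have "0 \<le> \<phi> $ a" for a
    using Q \<phi>(1) by (auto simp: Prob_def)
  ultimately have "\<phi> \<bullet> action_gain r u \<alpha> s p \<le> 0"
    unfolding inner_vec_def
    by (auto intro!: sum_nonpos simp: mult_nonneg_nonpos less_imp_le)
  with \<phi>(2) show False by (simp add: bellman_payoff_eq_inner)
qed

theorem theorem7:
  fixes r :: "'s::finite \<Rightarrow> 'a::finite \<Rightarrow> real"
    and Q :: "(real ^ 'a) set"
    and P :: "'s \<Rightarrow> (real ^ 's ^ 'a) set"
    and u' :: "'s \<Rightarrow> real"
    and \<alpha>' :: real
  assumes "\<And>s a. r s a \<in> {0..1}"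
    and "Q \<noteq> {}" and "Q \<subseteq> Prob"
    and "\<And>s. P s \<noteq> {}" and "\<And>s. P s \<subseteq> kernels"
    and "\<alpha>' \<in> {0..1}"
    and "solves_inf_sup r Q P u' \<alpha>'"
    and "(convex Q \<and> (\<forall>s. convex (P s)) \<and> (compact Q \<or> (\<forall>s. compact (P s))))
       \<or> (range dirac \<subseteq> Q \<and> sa_rectangular P)"
  shows "solves_robust_bellman r Q P u' \<alpha>'"
proof -
  have zero: "\<exists>\<phi>\<in>Q. \<forall>p\<in>P s. 0 \<le> bellman_payoff r u' \<alpha> s \<phi> p"
    if answer: "\<And>p. p \<in> P s \<Longrightarrow> \<exists>\<phi>\<in>Q. 0 < bellman_payoff r u' \<alpha> s \<phi> p" for s \<alpha>
  proof -
    consider "convex Q" "convex (P s)" "compact Q" | "convex Q" "convex (P s)" "compact (P s)"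
      | "range dirac \<subseteq> Q" "sa_rectangular P"
      using assms(8) by blast
    then show ?thesis
    proof cases
      case 1
      then show ?thesis
        by (intro policy_secures_zero_compact_policies assms(2,4) answer)
    next
      case 2
      then show ?thesis
        by (intro policy_secures_zero_compact_kernels assms(2,4) answer)
    next
      case 3
      then obtain Psa where "P s = {p. \<forall>a. p $ a \<in> Psa a}"
        unfolding sa_rectangular_def by meson
      from policy_secures_zero_rectangular[OF 3(1) assms(3) this answer]
      show ?thesis .
    qed
  qed
  have "(INF p\<in>P s. SUP \<phi>\<in>Q. bellman_payoff r u' \<alpha>' s \<phi> p)
      = (SUP \<phi>\<in>Q. INF p\<in>P s. bellman_payoff r u' \<alpha>' s \<phi> p)" for s
  proof (rule inf_sup_eq_sup_inf_if_levels_secured[OF assms(2,4)])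
    show "\<bar>bellman_payoff r u' \<alpha>' s \<phi> p\<bar> \<le> (\<Sum>a\<in>UNIV. \<Sum>s'\<in>UNIV. \<bar>r s a - \<alpha>' + u' s'\<bar>)"
      if "\<phi> \<in> Q" "p \<in> P s" for \<phi> p
      by (rule bellman_payoff_bounded[OF subsetD[OF assms(3)] subsetD[OF assms(5)]]) fact+
  next
    fix c
    assume answer: "\<And>p. p \<in> P s \<Longrightarrow> \<exists>\<phi>\<in>Q. c < bellman_payoff r u' \<alpha>' s \<phi> p"
    have shift: "bellman_payoff r u' (\<alpha>' + c) s \<phi> p = bellman_payoff r u' \<alpha>' s \<phi> p - c"
      if "\<phi> \<in> Q" "p \<in> P s" for \<phi> p
      by (rule bellman_payoff_shift[OF subsetD[OF assms(3)] subsetD[OF assms(5)]]) fact+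
    have "\<exists>\<phi>\<in>Q. \<forall>p\<in>P s. 0 \<le> bellman_payoff r u' (\<alpha>' + c) s \<phi> p"
    proof (rule zero)
      fix p assume "p \<in> P s"
      with answer[OF this] show "\<exists>\<phi>\<in>Q. 0 < bellman_payoff r u' (\<alpha>' + c) s \<phi> p"
        by (simp add: shift cong: bex_cong)
    qed
    then show "\<exists>\<phi>\<in>Q. \<forall>p\<in>P s. c \<le> bellman_payoff r u' \<alpha>' s \<phi> p"
      by (simp add: shift cong: bex_cong ball_cong)
  qed
  with assms(7) show ?thesis
    by (simp add: solves_inf_sup_def solves_robust_bellman_def)
qed

end
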